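(* Let $H\neq\{0\}$ be a separable Hilbert space, let $-\infty<a<b<\infty$, and let $A$ be a self-adjoint operator in $H$ with $A=A^*\ge0$ and $A\,W_2^1(H,(a,b))\subset L_2(H,(a,b))$. Let $L_0$ be the minimal operator generated in $L_2(H,(a,b))$ by the differential-operator expression $l(u)=u'+Au$. Then $L_0$ has no m-sectorial extension; that is, there are no $\varphi$ with $0\le\varphi<\pi/2$ and no operator $\tilde L\in S_{\varphi}(L_2(H,(a,b)))$ with $L_0\subset\tilde L$.
   Context: $L_2(H,(a,b))$ is the Hilbert space of square-integrable $H$-valued functions on $(a,b)$, and $W_2^1(H,(a,b))$ is the Sobolev space of $u\in L_2(H,(a,b))$ with weak derivative $u'\in L_2(H,(a,b))$. The operator $A$ acts pointwise, $(Au)(t)=A(u(t))$; the inclusion $A\,W_2^1(H,(a,b))\subset L_2(H,(a,b))$ means that $Au$ is defined and lies in $L_2(H,(a,b))$ for every $u\in W_2^1(H,(a,b))$. The minimal operator $L_0$ is the closure in $L_2(H,(a,b))$ of the operator $L_0'u=u'+Au$ with the dense domain $$D_0'=\Big\{u\in L_2(H,(a,b)):\ u(t)=\sum_{k=1}^n\varphi_k(t)f_k,\ \varphi_k\in C_0^\infty(a,b),\ f_k\in D(A),\ k=1,\dots,n,\ n\in\mathbb{N}\Big\}.$$ For a Hilbert space $\mathcal{H}$, a linear operator $T$ in $\mathcal{H}$ is accretive if $\operatorname{Re}(Tx,x)\ge0$ for all $x\in D(T)$, and m-accretive if it is accretive and has no proper accretive extension in $\mathcal{H}$. $S_{\varphi}(\mathcal{H})$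 denotes the set of densely defined closed linear operators $T$ in $\mathcal{H}$ that are m-accretive and satisfy $\cos\varphi\,|\operatorname{Im}(Tx,x)|\le\sin\varphi\,\operatorname{Re}(Tx,x)$ for all $x\in D(T)$. *)

theory Defs
  imports "HOL-Analysis.Analysis"
begin

section \<open>Complex inner product spaces\<close>

text \<open>
  A complex Hilbert space is a type of sort \<open>{complex_inner, banach}\<close>; adding
  \<open>second_countable_topology\<close> makes it separable. The form is linear in its first argument. The
  real inner product, hence norm and topology, is determined by \<open>cinner_inner\<close>.
\<close>

class complex_inner = real_inner +
  fixes scaleC :: "complex \<Rightarrow> 'a \<Rightarrow> 'a"  (infixr \<open>*\<^sub>C\<close> 75)
    and cinner :: "'a \<Rightarrow> 'a \<Rightarrow> complex"
  assumes scaleC_add_right: "c *\<^sub>C (x + y) = c *\<^sub>C x + c *\<^sub>C y"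
    and scaleC_add_left: "(c + d) *\<^sub>C x = c *\<^sub>C x + d *\<^sub>C x"
    and scaleC_scaleC: "c *\<^sub>C d *\<^sub>C x = (c * d) *\<^sub>C x"
    and scaleR_scaleC: "r *\<^sub>R x = complex_of_real r *\<^sub>C x"
    and cinner_commute: "cinner x y = cnj (cinner y x)"
    and cinner_add_left: "cinner (x + y) z = cinner x z + cinner y z"
    and cinner_scaleC_left: "cinner (c *\<^sub>C x) y = c * cinner x y"
    and cinner_inner: "inner x y = Re (cinner x y)"

instantiation complex :: complex_inner
begin
definition "scaleC_complex = (\<lambda>c x :: complex. c * x)"
definition "cinner_complex = (\<lambda>x y :: complex. x * cnj y)"
instance
  by standard
    (auto simp: scaleC_complex_def cinner_complex_def algebra_simps scaleR_conv_of_real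
      inner_complex_def)
end

lemma norm_cinner: "cinner x x = complex_of_real ((norm (x :: 'a::complex_inner))\<^sup>2)"
proof (rule complex_eqI)
  show "Im (cinner x x) = Im (complex_of_real ((norm x)\<^sup>2))"
    using arg_cong[OF cinner_commute[of x x], of Im] by simp
  show "Re (cinner x x) = Re (complex_of_real ((norm x)\<^sup>2))"
    by (simp add: cinner_inner[symmetric] power2_norm_eq_inner)
qed

lemma norm_scaleC: "norm (c *\<^sub>C (x :: 'a::complex_inner)) = cmod c * norm x"
proof -
  have "cinner (c *\<^sub>C x) (c *\<^sub>C x) = c * cnj c * cinner x x"
    by (simp add: cinner_scaleC_left cinner_commute[of x "c *\<^sub>C x"])
      (metis cinner_commute)
  then have "complex_of_real ((norm (c *\<^sub>C x))\<^sup>2) = complex_of_real ((cmod c * norm x)\<^sup>2)"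
    by (simp add: norm_cinner complex_norm_square power_mult_distrib del: of_real_power)
  then have "(norm (c *\<^sub>C x))\<^sup>2 = (cmod c * norm x)\<^sup>2"
    using of_real_eq_iff by blast
  then show ?thesis
    by (simp add: power2_eq_iff_nonneg)
qed

lemma continuous_scaleC: "continuous_on UNIV (\<lambda>x :: 'a::complex_inner. c *\<^sub>C x)"
proof -
  have "bounded_linear (\<lambda>x :: 'a. c *\<^sub>C x)"
    by (rule bounded_linear_intro[where K = "cmod c"])
      (auto simp: scaleC_add_right scaleR_scaleC scaleC_scaleC norm_scaleC mult.commute)
  then show ?thesis
    by (rule linear_continuous_on)
qed

lemma cinner_eq_inner:
  "cinner (x :: 'a::complex_inner) y = Complex (inner x y) (inner ((- \<i>) *\<^sub>C x) y)"
  by (rule complex_eqI) (simp_all add: cinner_inner cinner_scaleC_left)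

lemma borel_measurable_cinner:
  fixes f g :: "'b \<Rightarrow> 'a::{complex_inner, second_countable_topology}"
  assumes "f \<in> borel_measurable M" "g \<in> borel_measurable M"
  shows "(\<lambda>t. cinner (f t) (g t)) \<in> borel_measurable M"
proof -
  have "(\<lambda>t. (- \<i>) *\<^sub>C f t) \<in> borel_measurable M"
    by (rule borel_measurable_continuous_on[OF continuous_scaleC assms(1)])
  then show ?thesis
    using assms by (subst cinner_eq_inner) (simp add: Complex_eq)
qed

section \<open>Linear operators in a Hilbert space\<close>

text \<open>
  Since \<open>L\<^sub>2(H,(a,b))\<close> depends on the reals \<open>a\<close> and \<open>b\<close> it is not a type. Operator notions are
  therefore stated for a space given by explicit carrier and operations, and cover both \<open>H\<close> and
  \<open>L\<^sub>2(H,(a,b))\<close>.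
\<close>

record 'v hspace =
  vecs :: "'v set"
  vadd :: "'v \<Rightarrow> 'v \<Rightarrow> 'v"
  vscale :: "complex \<Rightarrow> 'v \<Rightarrow> 'v"
  vinner :: "'v \<Rightarrow> 'v \<Rightarrow> complex"

definition type_space :: "('h::complex_inner) hspace" where
  "type_space = \<lparr>vecs = UNIV, vadd = (+), vscale = (*\<^sub>C), vinner = cinner\<rparr>"

definition vdist :: "'v hspace \<Rightarrow> 'v \<Rightarrow> 'v \<Rightarrow> real" where
  "vdist X x y =
     (let d = vadd X x (vscale X (- 1) y) in sqrt (Re (vinner X d d)))"

definition converges :: "'v hspace \<Rightarrow> (nat \<Rightarrow> 'v) \<Rightarrow> 'v \<Rightarrow> bool" where
  "converges X s x \<longleftrightarrow> (\<lambda>n. vdist X (s n) x) \<longlonglongrightarrow> 0"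

text \<open>A possibly unbounded operator \<open>T\<close> is identified with its graph, so that \<open>(x, y) \<in> T\<close> means
  \<open>x \<in> D(T)\<close> and \<open>T x = y\<close>, and \<open>T \<subseteq> S\<close> means that \<open>S\<close> extends \<open>T\<close>.\<close>

definition linear_operator :: "'v hspace \<Rightarrow> ('v \<times> 'v) set \<Rightarrow> bool" where
  "linear_operator X T \<longleftrightarrow>
     T \<subseteq> vecs X \<times> vecs X \<and> T \<noteq> {} \<and> single_valued T \<and>
     (\<forall>(x, y)\<in>T. \<forall>(x', y')\<in>T. (vadd X x x', vadd X y y') \<in> T) \<and>
     (\<forall>c. \<forall>(x, y)\<in>T. (vscale X c x, vscale X c y) \<in> T)"

definition op_apply :: "('v \<times> 'v) set \<Rightarrow> 'v \<Rightarrow> 'v" where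
  "op_apply T x = (THE y. (x, y) \<in> T)"

definition densely_defined :: "'v hspace \<Rightarrow> ('v \<times> 'v) set \<Rightarrow> bool" where
  "densely_defined X T \<longleftrightarrow>
     (\<forall>x\<in>vecs X. \<exists>s. (\<forall>n. s n \<in> Domain T) \<and> converges X s x)"

definition op_closure :: "'v hspace \<Rightarrow> ('v \<times> 'v) set \<Rightarrow> ('v \<times> 'v) set" where
  "op_closure X T =
     {(x, y) \<in> vecs X \<times> vecs X.
        \<exists>s r. (\<forall>n. (s n, r n) \<in> T) \<and> converges X s x \<and> converges X r y}"

definition closed_operator :: "'v hspace \<Rightarrow> ('v \<times> 'v) set \<Rightarrow> bool" where
  "closed_operator X T \<longleftrightarrow> linear_operator X T \<and> op_closure X T \<subseteq> T"

definition op_adjoint :: "'v hspace \<Rightarrow> ('v \<times> 'v) set \<Rightarrow> ('v \<times> 'v) set" where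
  "op_adjoint X T =
     {(y, z) \<in> vecs X \<times> vecs X. \<forall>(x, w)\<in>T. vinner X w y = vinner X x z}"

definition self_adjoint :: "'v hspace \<Rightarrow> ('v \<times> 'v) set \<Rightarrow> bool" where
  "self_adjoint X T \<longleftrightarrow>
     linear_operator X T \<and> densely_defined X T \<and> op_adjoint X T = T"

definition nonneg_operator :: "'v hspace \<Rightarrow> ('v \<times> 'v) set \<Rightarrow> bool" where
  "nonneg_operator X T \<longleftrightarrow>
     (\<forall>(x, y)\<in>T. vinner X y x \<in> \<real> \<and> Re (vinner X y x) \<ge> 0)"

definition accretive :: "'v hspace \<Rightarrow> ('v \<times> 'v) set \<Rightarrow> bool" where
  "accretive X T \<longleftrightarrow> linear_operator X T \<and> (\<forall>(x, y)\<in>T. Re (vinner X y x) \<ge> 0)"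

definition m_accretive :: "'v hspace \<Rightarrow> ('v \<times> 'v) set \<Rightarrow> bool" where
  "m_accretive X T \<longleftrightarrow> accretive X T \<and> \<not> (\<exists>S. accretive X S \<and> T \<subset> S)"

definition m_sectorial :: "real \<Rightarrow> 'v hspace \<Rightarrow> ('v \<times> 'v) set set" where
  "m_sectorial \<phi> X =
     {T. densely_defined X T \<and> closed_operator X T \<and> m_accretive X T \<and>
         (\<forall>(x, y)\<in>T. cos \<phi> * \<bar>Im (vinner X y x)\<bar> \<le> sin \<phi> * Re (vinner X y x))}"

section \<open>The space of square-integrable functions\<close>

definition L2_fun :: "real \<Rightarrow> real \<Rightarrow> (real \<Rightarrow> 'h::{complex_inner, second_countable_topology}) set"
  where
  "L2_fun a b =
     {f. f \<in> borel_measurable (lebesgue_on {a<..<b}) \<and>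
         integrable (lebesgue_on {a<..<b}) (\<lambda>t. (norm (f t))\<^sup>2)}"

definition L2_rel ::
  "real \<Rightarrow> real \<Rightarrow>
    ((real \<Rightarrow> 'h::{complex_inner, second_countable_topology}) \<times> (real \<Rightarrow> 'h)) set" where
  "L2_rel a b =
     {(f, g) \<in> L2_fun a b \<times> L2_fun a b. AE t in lebesgue_on {a<..<b}. f t = g t}"

definition L2_class ::
  "real \<Rightarrow> real \<Rightarrow> (real \<Rightarrow> 'h::{complex_inner, second_countable_topology}) \<Rightarrow> (real \<Rightarrow> 'h) set"
  where
  "L2_class a b f = L2_rel a b `` {f}"

text \<open>The unions and the definite description below do not depend on representatives; see the
  lemmas \<open>L2_vadd\<close>, \<open>L2_vscale\<close> and \<open>L2_vinner\<close>.\<close>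

definition L2_space ::
  "real \<Rightarrow> real \<Rightarrow> (real \<Rightarrow> 'h::{complex_inner, second_countable_topology}) set hspace" where
  "L2_space a b =
     \<lparr>vecs = L2_fun a b // L2_rel a b,
      vadd = (\<lambda>F G. \<Union>f\<in>F. \<Union>g\<in>G. L2_class a b (\<lambda>t. f t + g t)),
      vscale = (\<lambda>c F. \<Union>f\<in>F. L2_class a b (\<lambda>t. c *\<^sub>C f t)),
      vinner = (\<lambda>F G. THE z. \<exists>f\<in>F. \<exists>g\<in>G.
                  z = (LINT t|lebesgue_on {a<..<b}. cinner (f t) (g t)))\<rparr>"

lemma equiv_L2_rel: "equiv (L2_fun a b) (L2_rel a b)"
  by (intro equivI refl_onI symI transI) (auto simp: L2_rel_def)

lemma L2_fun_add:
  assumes "f \<in> L2_fun a b" "g \<in> L2_fun a b"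
  shows "(\<lambda>t. f t + g t) \<in> L2_fun a b"
proof -
  have le: "(norm (x + y))\<^sup>2 \<le> 2 * (norm x)\<^sup>2 + 2 * (norm y)\<^sup>2" for x y :: 'a
  proof -
    have "(norm (x + y))\<^sup>2 \<le> (norm x + norm y)\<^sup>2"
      by (intro power_mono norm_triangle_ineq) simp
    also have "\<dots> \<le> 2 * (norm x)\<^sup>2 + 2 * (norm y)\<^sup>2"
      using zero_le_power2[of "norm x - norm y"] by (simp add: power2_eq_square algebra_simps)
    finally show ?thesis .
  qed
  have "integrable (lebesgue_on {a<..<b}) (\<lambda>t. (norm (f t + g t))\<^sup>2)"
  proof (rule Bochner_Integration.integrable_bound)
    show "integrable (lebesgue_on {a<..<b}) (\<lambda>t. 2 * (norm (f t))\<^sup>2 + 2 * (norm (g t))\<^sup>2)"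
      using assms by (simp add: L2_fun_def)
  qed (use assms le in \<open>auto simp: L2_fun_def\<close>)
  then show ?thesis
    using assms by (auto simp: L2_fun_def intro: borel_measurable_add)
qed

lemma L2_fun_scaleC:
  assumes "f \<in> L2_fun a b"
  shows "(\<lambda>t. c *\<^sub>C f t) \<in> L2_fun a b"
proof -
  have "(\<lambda>t. c *\<^sub>C f t) \<in> borel_measurable (lebesgue_on {a<..<b})"
    using assms by (intro borel_measurable_continuous_on[OF continuous_scaleC])
      (simp add: L2_fun_def)
  then show ?thesis
    using assms by (simp add: L2_fun_def norm_scaleC power_mult_distrib)
qed

lemma L2_class_mem: "f \<in> L2_fun a b \<Longrightarrow> L2_class a b f \<in> vecs (L2_space a b)"
  by (simp add: L2_class_def L2_space_def quotientI)

lemma L2_class_eq_iff: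
  assumes "f \<in> L2_fun a b" "g \<in> L2_fun a b"
  shows "L2_class a b f = L2_class a b g \<longleftrightarrow> (AE t in lebesgue_on {a<..<b}. f t = g t)"
  unfolding L2_class_def using assms
  by (subst eq_equiv_class_iff[OF equiv_L2_rel]) (auto simp: L2_rel_def)

lemma L2_class_iff: "f' \<in> L2_class a b f \<longleftrightarrow> (f, f') \<in> L2_rel a b"
  by (simp add: L2_class_def)

lemma L2_class_refl: "f \<in> L2_fun a b \<Longrightarrow> f \<in> L2_class a b f"
  by (simp add: L2_class_iff L2_rel_def)

lemma L2_vadd:
  assumes "f \<in> L2_fun a b" "g \<in> L2_fun a b"
  shows "vadd (L2_space a b) (L2_class a b f) (L2_class a b g) = L2_class a b (\<lambda>t. f t + g t)"
proof -
  have eq: "L2_class a b (\<lambda>t. f' t + g' t) = L2_class a b (\<lambda>t. f t + g t)"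
    if "f' \<in> L2_class a b f" "g' \<in> L2_class a b g" for f' g'
    using that by (subst L2_class_eq_iff) (auto simp: L2_class_iff L2_rel_def intro: L2_fun_add)
  have "(\<Union>f'\<in>L2_class a b f. \<Union>g'\<in>L2_class a b g. L2_class a b (\<lambda>t. f' t + g' t)) =
      L2_class a b (\<lambda>t. f t + g t)"
    by (intro ballI UN_constant_eq[OF L2_class_refl[OF assms(1)]]
        UN_constant_eq[OF L2_class_refl[OF assms(2)]] eq)
  then show ?thesis
    by (simp only: L2_space_def hspace.simps)
qed

lemma L2_vscale:
  assumes "f \<in> L2_fun a b"
  shows "vscale (L2_space a b) c (L2_class a b f) = L2_class a b (\<lambda>t. c *\<^sub>C f t)"
proof -
  have eq: "L2_class a b (\<lambda>t. c *\<^sub>C f' t) = L2_class a b (\<lambda>t. c *\<^sub>C f t)"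
    if "f' \<in> L2_class a b f" for f'
    using that
    by (subst L2_class_eq_iff) (auto simp: L2_class_iff L2_rel_def intro: L2_fun_scaleC)
  have "(\<Union>f'\<in>L2_class a b f. L2_class a b (\<lambda>t. c *\<^sub>C f' t)) = L2_class a b (\<lambda>t. c *\<^sub>C f t)"
    by (intro ballI UN_constant_eq[OF L2_class_refl[OF assms]] eq)
  then show ?thesis
    by (simp only: L2_space_def hspace.simps)
qed

lemma L2_vinner:
  assumes "f \<in> L2_fun a b" "g \<in> L2_fun a b"
  shows "vinner (L2_space a b) (L2_class a b f) (L2_class a b g) =
    (LINT t|lebesgue_on {a<..<b}. cinner (f t) (g t))"
proof -
  have eq: "(LINT t|lebesgue_on {a<..<b}. cinner (f' t) (g' t)) =
      (LINT t|lebesgue_on {a<..<b}. cinner (f t) (g t))"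
    if "f' \<in> L2_class a b f" "g' \<in> L2_class a b g" for f' g'
    using that
    by (intro integral_cong_AE borel_measurable_cinner)
      (auto simp: L2_class_iff L2_rel_def L2_fun_def)
  have "(THE z. \<exists>f'\<in>L2_class a b f. \<exists>g'\<in>L2_class a b g.
        z = (LINT t|lebesgue_on {a<..<b}. cinner (f' t) (g' t))) =
      (LINT t|lebesgue_on {a<..<b}. cinner (f t) (g t))"
    by (rule the_equality)
      (use eq L2_class_refl[OF assms(1)] L2_class_refl[OF assms(2)] in blast)+
  then show ?thesis
    by (simp only: L2_space_def hspace.simps)
qed

section \<open>The minimal operator\<close>

text \<open>Elements of \<open>C\<^sub>0\<^sup>\<infinity>(a,b)\<close> are extended by zero to the real line.\<close>

definition test_functions :: "real \<Rightarrow> real \<Rightarrow> (real \<Rightarrow> complex) set" where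
  "test_functions a b =
     {\<phi>. (\<forall>n t. ((\<lambda>g s. vector_derivative g (at s)) ^^ n) \<phi> differentiable at t) \<and>
         compact (closure {t. \<phi> t \<noteq> 0}) \<and> closure {t. \<phi> t \<noteq> 0} \<subseteq> {a<..<b}}"

definition weak_derivative ::
  "real \<Rightarrow> real \<Rightarrow> (real \<Rightarrow> 'h::{complex_inner, banach, second_countable_topology}) \<Rightarrow>
    (real \<Rightarrow> 'h) \<Rightarrow> bool" where
  "weak_derivative a b u v \<longleftrightarrow>
     (\<forall>\<phi>\<in>test_functions a b.
        (LINT t|lebesgue_on {a<..<b}. vector_derivative \<phi> (at t) *\<^sub>C u t) =
        - (LINT t|lebesgue_on {a<..<b}. \<phi> t *\<^sub>C v t))"

definition W21 ::
  "real \<Rightarrow> real \<Rightarrow> (real \<Rightarrow> 'h::{complex_inner, banach, second_countable_topology}) set" where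
  "W21 a b = {u \<in> L2_fun a b. \<exists>v\<in>L2_fun a b. weak_derivative a b u v}"

text \<open>\<open>A W\<^sub>2\<^sup>1(H,(a,b)) \<subseteq> L\<^sub>2(H,(a,b))\<close>: as elements of \<open>W\<^sub>2\<^sup>1\<close> are determined up to null sets,
  \<open>A u\<close> is defined when \<open>u(t) \<in> D(A)\<close> for almost every \<open>t\<close>.\<close>

definition maps_W21_into_L2 ::
  "real \<Rightarrow> real \<Rightarrow> (('h::{complex_inner, banach, second_countable_topology}) \<times> 'h) set \<Rightarrow> bool"
  where
  "maps_W21_into_L2 a b A \<longleftrightarrow>
     (\<forall>u\<in>W21 a b. (AE t in lebesgue_on {a<..<b}. u t \<in> Domain A) \<and>
        (\<exists>v\<in>L2_fun a b. AE t in lebesgue_on {a<..<b}. v t = op_apply A (u t)))"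

definition D0' :: "real \<Rightarrow> real \<Rightarrow> (('h::complex_inner) \<times> 'h) set \<Rightarrow> (real \<Rightarrow> 'h) set" where
  "D0' a b A =
     {u. \<exists>n \<phi> f. (\<forall>k\<in>{1..n::nat}. \<phi> k \<in> test_functions a b \<and> f k \<in> Domain A) \<and>
         u = (\<lambda>t. \<Sum>k=1..n. \<phi> k t *\<^sub>C f k)}"

definition L0' ::
  "real \<Rightarrow> real \<Rightarrow> (('h::{complex_inner, banach, second_countable_topology}) \<times> 'h) set \<Rightarrow>
    ((real \<Rightarrow> 'h) set \<times> (real \<Rightarrow> 'h) set) set" where
  "L0' a b A =
     {(L2_class a b u, L2_class a b (\<lambda>t. vector_derivative u (at t) + op_apply A (u t))) |u.
        u \<in> D0' a b A}"

definition minimal_operator ::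
  "real \<Rightarrow> real \<Rightarrow> (('h::{complex_inner, banach, second_countable_topology}) \<times> 'h) set \<Rightarrow>
    ((real \<Rightarrow> 'h) set \<times> (real \<Rightarrow> 'h) set) set" where
  "minimal_operator a b A = op_closure (L2_space a b) (L0' a b A)"

end

theory Submission
  imports Defs "HOL-Computational_Algebra.Polynomial"
begin

text \<open>
  A sectorial extension of \<open>L\<^sub>0\<close> would make \<open>L\<^sub>0\<close> itself satisfy the sector inequality, and
  high-frequency functions in \<open>D\<^sub>0'\<close> violate it. Take \<open>f \<in> D(A)\<close> with \<open>f \<noteq> 0\<close>, a real bump
  function \<open>\<psi> \<in> C\<^sub>0\<^sup>\<infinity>(a,b)\<close>, and \<open>u(t) = e\<^sup>i\<^sup>r\<^sup>t \<psi>(t) f\<close>. The modulus of \<open>u\<close> is independent of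
  \<open>r\<close>, and differentiating the wave contributes the factor \<open>ir\<close>, so that
  \<open>(L\<^sub>0 u, u) = C + i r D\<close>, where \<open>D = \<parallel>f\<parallel>\<^sup>2 \<integral> \<psi>\<^sup>2 > 0\<close> and \<open>C\<close> does not depend on \<open>r\<close>. As
  \<open>r\<close> varies these numbers fill a whole vertical line, which no sector of half-angle
  \<open>\<phi> < \<pi>/2\<close> contains (\<open>minimal_operator_form_unbounded\<close>).

  What remains is to have a bump \<open>\<psi>\<close> such that \<open>e\<^sup>i\<^sup>r\<^sup>t \<psi>(t)\<close> has derivatives of every order
  (\<open>bump_exists\<close>). It is built from \<open>e\<^sup>-\<^sup>1\<^sup>/\<^sup>t\<close> inside an algebra of functions that is closed under
  differentiation.
\<close>

section \<open>Smooth bump functions\<close>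

text \<open>Smoothness without computing higher derivatives: it suffices to exhibit a set of functions
  that differentiation does not leave.\<close>

lemma iterated_vector_derivative_differentiable:
  fixes S :: "(real \<Rightarrow> complex) set"
  assumes "f \<in> S"
    and "\<And>f. f \<in> S \<Longrightarrow> \<exists>g\<in>S. \<forall>t. (f has_vector_derivative g t) (at t)"
  shows "((\<lambda>g s. vector_derivative g (at s)) ^^ n) f differentiable at t"
proof -
  have step: "(\<lambda>s. vector_derivative g (at s)) \<in> S" if "g \<in> S" for g
  proof -
    obtain h where "h \<in> S" "\<forall>t. (g has_vector_derivative h t) (at t)"
      using assms(2) \<open>g \<in> S\<close> by blast
    moreover from this have "(\<lambda>s. vector_derivative g (at s)) = h"
      by (auto intro: vector_derivative_at)
    ultimately show ?thesis
      by simp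
  qed
  have "((\<lambda>g s. vector_derivative g (at s)) ^^ n) f \<in> S"
    using assms(1) by (induction n) (simp_all add: step)
  then show ?thesis
    using assms(2) by (meson differentiableI_vector)
qed

text \<open>The functions \<open>p(1/t) e\<^sup>-\<^sup>1\<^sup>/\<^sup>t\<close>, flat at \<open>0\<close>. The polynomial factor makes the family closed under
  differentiation: the derivative belongs to \<open>x\<^sup>2 (p - p')\<close>.\<close>

definition flat :: "real poly \<Rightarrow> real \<Rightarrow> real" where
  "flat p t = (if t > 0 then poly p (inverse t) * exp (- inverse t) else 0)"

lemma poly_times_exp_neg_tendsto_0: "((\<lambda>x::real. poly p x * exp (- x)) \<longlongrightarrow> 0) at_top"
proof -
  have "((\<lambda>x::real. \<Sum>i\<le>degree p. coeff p i * (x ^ i / exp x)) \<longlongrightarrow> (\<Sum>i\<le>degree p. coeff p i * 0)) at_top"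
    by (intro tendsto_intros tendsto_power_div_exp_0)
  then show ?thesis
    by (simp add: poly_altdef sum_distrib_right exp_minus divide_inverse mult.assoc)
qed

text \<open>On the right, substituting \<open>x = 1/h\<close> turns the difference quotient into a polynomial times
  \<open>e\<^sup>-\<^sup>x\<close> at infinity.\<close>

lemma flat_has_derivative_at_0: "(flat p has_real_derivative 0) (at 0)"
proof -
  have "((\<lambda>h. flat p h / h) \<longlongrightarrow> 0) (at_right 0)"
  proof (rule Lim_transform_eventually)
    show "((\<lambda>h. poly (pCons 0 p) (inverse h) * exp (- inverse h)) \<longlongrightarrow> 0) (at_right 0)"
      by (rule filterlim_compose[OF poly_times_exp_neg_tendsto_0 filterlim_inverse_at_top_right])
    show "\<forall>\<^sub>F h in at_right 0.
        poly (pCons 0 p) (inverse h) * exp (- inverse h) = flat p h / h"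
      using eventually_at_right_less[of 0]
      by eventually_elim (simp add: flat_def field_simps)
  qed
  moreover have "((\<lambda>h. flat p h / h) \<longlongrightarrow> 0) (at_left 0)"
  proof (rule Lim_transform_eventually[OF tendsto_const])
    show "\<forall>\<^sub>F h in at_left 0. 0 = flat p h / h"
      by (auto simp: flat_def eventually_at_filter)
  qed
  ultimately have "((\<lambda>h. flat p h / h) \<longlongrightarrow> 0) (at 0)"
    by (simp add: filterlim_at_split)
  then show ?thesis
    by (simp add: has_field_derivative_iff flat_def)
qed

lemma flat_has_derivative:
  "(flat p has_real_derivative flat ([:0, 0, 1:] * (p - pderiv p)) t) (at t)"
proof -
  consider "t < 0" | "t = 0" | "t > 0"
    by linarith
  then show ?thesis
  proof cases
    case 1
    have "((\<lambda>_. 0) has_real_derivative 0) (at t)"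
      by simp
    then have "(flat p has_real_derivative 0) (at t)"
      by (rule has_field_derivative_transform_within_open[of _ _ _ "{..<0}"])
        (use 1 in \<open>auto simp: flat_def\<close>)
    then show ?thesis
      using 1 by (simp add: flat_def)
  next
    case 2
    then show ?thesis
      using flat_has_derivative_at_0[of p] by (simp add: flat_def)
  next
    case 3
    have "((\<lambda>t. poly p (inverse t) * exp (- inverse t)) has_real_derivative
        flat ([:0, 0, 1:] * (p - pderiv p)) t) (at t)"
      using 3
      by (auto intro!: derivative_eq_intros DERIV_chain'[OF _ poly_DERIV]
          simp: flat_def field_simps)
    then show ?thesis
      by (rule has_field_derivative_transform_within_open[of _ _ _ "{0<..}"])
        (use 3 in \<open>auto simp: flat_def\<close>)
  qed
qed

lemma flat_affine_has_derivative:
  "((\<lambda>t. flat p (r * t + s)) has_real_derivative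
      r * flat ([:0, 0, 1:] * (p - pderiv p)) (r * t + s)) (at t)"
proof -
  have "((\<lambda>t. r * t + s) has_real_derivative r) (at t)"
    by (auto intro!: derivative_eq_intros)
  then show ?thesis
    using DERIV_chain'[OF _ flat_has_derivative, of "\<lambda>t. r * t + s" r t] by (simp add: mult.commute)
qed

text \<open>Closed under differentiation by the product rule, and containing every wave modulated by a
  product of two flat functions.\<close>

inductive_set smooth_algebra :: "(real \<Rightarrow> complex) set" where
  const: "(\<lambda>t. c) \<in> smooth_algebra"
| wave: "(\<lambda>t. cis (r * t)) \<in> smooth_algebra"
| flat: "(\<lambda>t. of_real (flat p (r * t + s))) \<in> smooth_algebra"
| add: "f \<in> smooth_algebra \<Longrightarrow> g \<in> smooth_algebra \<Longrightarrow> (\<lambda>t. f t + g t) \<in> smooth_algebra"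
| mult: "f \<in> smooth_algebra \<Longrightarrow> g \<in> smooth_algebra \<Longrightarrow> (\<lambda>t. f t * g t) \<in> smooth_algebra"

lemma cis_has_vector_derivative:
  "((\<lambda>t. cis (r * t)) has_vector_derivative \<i> * of_real r * cis (r * t)) (at t)"
  by (auto intro!: derivative_eq_intros simp: has_vector_derivative_def scaleR_conv_of_real)

lemma smooth_algebra_derivative:
  assumes "f \<in> smooth_algebra"
  shows "\<exists>g\<in>smooth_algebra. \<forall>t. (f has_vector_derivative g t) (at t)"
  using assms
proof induction
  case (const c)
  show ?case
    using smooth_algebra.const[of 0] by (auto intro!: bexI[of _ "\<lambda>_. 0"])
next
  case (wave r)
  show ?case
    using smooth_algebra.mult[OF smooth_algebra.const[of "\<i> * of_real r"] smooth_algebra.wave[of r]]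
    by (rule rev_bexI) (simp add: cis_has_vector_derivative)
next
  case (flat p r s)
  define q where "q = [:0, 0, 1:] * (p - pderiv p)"
  have "((\<lambda>t. complex_of_real (flat p (r * t + s))) has_vector_derivative
      of_real r * of_real (flat q (r * t + s))) (at t)" for t
    using has_vector_derivative_of_real[OF flat_affine_has_derivative, of p r s t]
    by (simp add: q_def)
  then show ?case
    using smooth_algebra.mult[OF smooth_algebra.const[of "of_real r"] smooth_algebra.flat[of q r s]]
    by (intro bexI[of _ "\<lambda>t. of_real r * of_real (flat q (r * t + s))"]) auto
next
  case (add f g)
  then obtain f' g' where "f' \<in> smooth_algebra" "g' \<in> smooth_algebra"
    "\<forall>t. (f has_vector_derivative f' t) (at t)" "\<forall>t. (g has_vector_derivative g' t) (at t)"
    by blast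
  then show ?case
    by (intro bexI[of _ "\<lambda>t. f' t + g' t"])
      (auto intro: smooth_algebra.add has_vector_derivative_add)
next
  case (mult f g)
  then obtain f' g' where "f' \<in> smooth_algebra" "g' \<in> smooth_algebra"
    "\<forall>t. (f has_vector_derivative f' t) (at t)" "\<forall>t. (g has_vector_derivative g' t) (at t)"
    by blast
  then show ?case
    using mult.hyps
    by (intro bexI[of _ "\<lambda>t. f t * g' t + f' t * g t"])
      (auto intro: smooth_algebra.add smooth_algebra.mult has_vector_derivative_mult)
qed

text \<open>The bump \<open>e\<^sup>-\<^sup>1\<^sup>/\<^sup>(\<^sup>t\<^sup>-\<^sup>c\<^sup>) e\<^sup>-\<^sup>1\<^sup>/\<^sup>(\<^sup>d\<^sup>-\<^sup>t\<^sup>)\<close> on \<open>(c, d)\<close>. One real bump serves all frequencies, so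
  that the constants of the quadratic form below do not depend on the frequency.\<close>

lemma bump_exists:
  fixes a b :: real
  assumes "a < b"
  obtains \<psi> \<psi>' :: "real \<Rightarrow> real" and c :: real
  where "\<And>t. (\<psi> has_real_derivative \<psi>' t) (at t)" "continuous_on UNIV \<psi>'"
    and "c \<in> {a<..<b}" "\<psi> c \<noteq> 0"
    and "\<And>r. (\<lambda>t. cis (r * t) * of_real (\<psi> t)) \<in> test_functions a b"
proof -
  \<comment> \<open>The support is \<open>{c..d}\<close>; the middle third keeps it away from the end points.\<close>
  define c d where "c = (2 * a + b) / 3" and "d = (a + 2 * b) / 3"
  have cd: "a < c" "c < d" "d < b"
    using assms by (auto simp: c_def d_def)
  \<comment> \<open>\<open>flat q\<close> is the derivative of \<open>flat 1\<close>.\<close>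
  define q :: "real poly" where "q = [:0, 0, 1:] * (1 - pderiv 1)"
  define \<psi> where "\<psi> t = flat 1 (t - c) * flat 1 (d - t)" for t
  define \<psi>' where "\<psi>' t = flat q (t - c) * flat 1 (d - t) - flat 1 (t - c) * flat q (d - t)" for t
  have flat: "((\<lambda>t. flat p (t - c)) has_real_derivative
      flat ([:0, 0, 1:] * (p - pderiv p)) (t - c)) (at t)"
    "((\<lambda>t. flat p (d - t)) has_real_derivative
      - flat ([:0, 0, 1:] * (p - pderiv p)) (d - t)) (at t)" for p t
    using flat_affine_has_derivative[of p 1 "- c" t] flat_affine_has_derivative[of p "- 1" d t]
    by simp_all
  have flat_cont: "continuous_on UNIV (\<lambda>t. flat p (t - c))" "continuous_on UNIV (\<lambda>t. flat p (d - t))"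
    for p
    using flat[of p] by (auto intro!: continuous_at_imp_continuous_on DERIV_isCont)
  have "(\<psi> has_real_derivative \<psi>' t) (at t)" for t
    unfolding \<psi>_def[abs_def] \<psi>'_def q_def
    by (auto intro!: derivative_eq_intros flat simp del: mult_pCons_left)
  moreover have "continuous_on UNIV \<psi>'"
    unfolding \<psi>'_def[abs_def] by (intro continuous_intros flat_cont)
  moreover have "(c + d) / 2 \<in> {a<..<b}" "\<psi> ((c + d) / 2) \<noteq> 0"
    using cd by (auto simp: \<psi>_def flat_def field_simps)
  moreover have "(\<lambda>t. cis (r * t) * of_real (\<psi> t)) \<in> test_functions a b" (is "?\<phi> \<in> _") for r
  proof -
    have "(\<lambda>t. complex_of_real (flat 1 (1 * t + - c)) * of_real (flat 1 (-1 * t + d)))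
        \<in> smooth_algebra"
      by (intro smooth_algebra.mult smooth_algebra.flat)
    then have "?\<phi> \<in> smooth_algebra"
      using smooth_algebra.mult[OF smooth_algebra.wave] by (simp add: \<psi>_def)
    moreover have "closure {t. ?\<phi> t \<noteq> 0} \<subseteq> {c..d}"
      by (rule closure_minimal) (auto simp: \<psi>_def flat_def split: if_splits)
    moreover from this have "compact (closure {t. ?\<phi> t \<noteq> 0})"
      using bounded_subset[OF bounded_closed_interval] by (auto simp: compact_eq_bounded_closed)
    ultimately show ?thesis
      using cd iterated_vector_derivative_differentiable[OF _ smooth_algebra_derivative]
      unfolding test_functions_def by force
  qed
  ultimately show thesis
    by (rule that)
qed

section \<open>Continuous functions as elements of the space of square-integrable functions\<close>

lemma continuous_integrable_interval:
  fixes f :: "real \<Rightarrow> 'b::{banach, second_countable_topology}"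
  assumes "continuous_on UNIV f"
  shows "integrable (lebesgue_on {a<..<b}) f"
proof -
  have "set_integrable lborel {a..b} f"
    by (intro borel_integrable_atLeastAtMost' continuous_on_subset[OF assms]) auto
  then have "set_integrable lborel {a<..<b} f"
    by (rule set_integrable_subset) auto
  then have "integrable lborel (\<lambda>t. indicator {a<..<b} t *\<^sub>R f t)"
    by (simp only: set_integrable_def)
  then have "integrable lebesgue (\<lambda>t. indicator {a<..<b} t *\<^sub>R f t)"
    using integrable_completion borel_measurable_integrable by blast
  then show ?thesis
    by (subst integrable_restrict_space) simp_all
qed

lemma continuous_L2_fun:
  fixes f :: "real \<Rightarrow> 'b::{complex_inner, banach, second_countable_topology}"
  assumes "continuous_on UNIV f"
  shows "f \<in> L2_fun a b"
  using continuous_integrable_interval[OF assms]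
    continuous_integrable_interval[OF continuous_on_power[OF continuous_on_norm[OF assms]]]
  by (auto simp: L2_fun_def)

text \<open>A square with zero integral vanishes almost everywhere, so the open set on which \<open>f\<close> does not
  vanish would be null and hence empty.\<close>

lemma integral_square_pos:
  fixes f :: "real \<Rightarrow> real"
  assumes "continuous_on UNIV f" "c \<in> {a<..<b}" "f c \<noteq> 0"
  shows "(LINT t|lebesgue_on {a<..<b}. (f t)\<^sup>2) > 0"
proof (rule ccontr)
  assume "\<not> ?thesis"
  moreover have int: "integrable (lebesgue_on {a<..<b}) (\<lambda>t. (f t)\<^sup>2)"
    by (intro continuous_integrable_interval continuous_intros assms(1))
  moreover have "(LINT t|lebesgue_on {a<..<b}. (f t)\<^sup>2) \<ge> 0"
    by simp
  ultimately have "(LINT t|lebesgue_on {a<..<b}. (f t)\<^sup>2) = 0"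
    by linarith
  then have "AE t in lebesgue_on {a<..<b}. f t = 0"
    using integral_nonneg_eq_0_iff_AE[OF int] by simp
  then have "AE t in lebesgue. t \<in> {a<..<b} \<longrightarrow> f t = 0"
    by (simp add: AE_restrict_space_iff)
  then have ae: "AE t in lebesgue. t \<notin> {t \<in> {a<..<b}. f t \<noteq> 0}"
    by (rule eventually_mono) blast
  have op: "open {t \<in> {a<..<b}. f t \<noteq> 0}"
  proof -
    have "open {t. f t \<noteq> 0}"
      using assms(1) by (intro open_Collect_neq) auto
    then show ?thesis
      using open_Int[OF open_greaterThanLessThan, of "{t. f t \<noteq> 0}" a b]
      by (simp only: Int_def mem_Collect_eq)
  qed
  then have "{t \<in> {a<..<b}. f t \<noteq> 0} \<in> sets lebesgue"
    by simp
  then have "negligible {t \<in> {a<..<b}. f t \<noteq> 0}"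
    using ae AE_iff_null_sets negligible_iff_null_sets by blast
  then show False
    using op open_not_negligible assms(2,3) by blast
qed

section \<open>The quadratic form of the minimal operator\<close>

lemma scaleC_minus_one: "(- 1) *\<^sub>C (x::'h::complex_inner) = - x"
  using scaleR_scaleC[of "-1" x] by simp

text \<open>In a nontrivial space \<open>{0}\<close> is not dense.\<close>

lemma dense_domain_nontrivial:
  fixes A :: "('h::complex_inner \<times> 'h) set"
  assumes "(UNIV :: 'h set) \<noteq> {0}" "densely_defined type_space A"
  obtains f g where "(f, g) \<in> A" "f \<noteq> 0"
proof -
  obtain x :: 'h where "x \<noteq> 0"
    using assms(1) by blast
  obtain s where s: "\<And>n. s n \<in> Domain A" "converges type_space s x"
    using assms(2) unfolding densely_defined_def by (force simp: type_space_def)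
  have "(\<lambda>n. norm (s n - x)) \<longlonglongrightarrow> 0"
    using s(2) by (simp add: converges_def vdist_def type_space_def Let_def cinner_inner[symmetric]
        norm_eq_sqrt_inner scaleC_minus_one)
  then have "s \<longlonglongrightarrow> x"
    by (rule LIM_zero_cancel[OF tendsto_norm_zero_cancel])
  then have "\<exists>n. s n \<noteq> 0"
    using \<open>x \<noteq> 0\<close> LIMSEQ_unique[OF _ tendsto_const[of 0]] by (cases "s = (\<lambda>_. 0)") auto
  then show thesis
    using s(1) that by blast
qed

lemma op_apply_eq: "single_valued T \<Longrightarrow> (x, y) \<in> T \<Longrightarrow> op_apply T x = y"
  unfolding op_apply_def by (auto dest: single_valuedD)

lemma L0'_subset_minimal_operator:
  fixes u v :: "real \<Rightarrow> 'h::{complex_inner, banach, second_countable_topology}"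
  assumes "u \<in> L2_fun a b" "v \<in> L2_fun a b" "(L2_class a b u, L2_class a b v) \<in> L0' a b A"
  shows "(L2_class a b u, L2_class a b v) \<in> minimal_operator a b A"
proof -
  have refl: "converges (L2_space a b) (\<lambda>_. L2_class a b f) (L2_class a b f)"
    if "f \<in> L2_fun a b" for f :: "real \<Rightarrow> 'h"
  proof -
    have "x + (- 1) *\<^sub>C x = 0" for x :: 'h
      by (simp add: scaleC_minus_one)
    moreover have "cinner (0::'h) 0 = 0"
      by (simp add: norm_cinner)
    ultimately have "vdist (L2_space a b) (L2_class a b f) (L2_class a b f) = 0"
      using that continuous_L2_fun[of "\<lambda>_. 0 :: 'h" a b]
      by (simp add: vdist_def Let_def L2_vscale L2_vadd L2_vinner L2_fun_add
          L2_fun_scaleC)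
    then show ?thesis
      by (simp add: converges_def)
  qed
  have "\<exists>s r. (\<forall>n. (s n, r n) \<in> L0' a b A) \<and> converges (L2_space a b) s (L2_class a b u) \<and>
      converges (L2_space a b) r (L2_class a b v)"
    by (intro exI[of _ "\<lambda>_. L2_class a b u"] exI[of _ "\<lambda>_. L2_class a b v"] conjI allI refl assms)
  then show ?thesis
    using assms(1,2) by (simp add: minimal_operator_def op_closure_def L2_class_mem)
qed

lemma bounded_linear_scaleC_left: "bounded_linear (\<lambda>c. c *\<^sub>C (f::'h::complex_inner))"
  by (rule bounded_linear_intro[where K = "norm f"])
    (auto simp: scaleC_add_left scaleC_scaleC norm_scaleC scaleR_scaleC scaleC_complex_def)

lemma scaleC_left_has_vector_derivative:
  assumes "(\<phi> has_vector_derivative d) (at t)"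
  shows "((\<lambda>t. \<phi> t *\<^sub>C f) has_vector_derivative d *\<^sub>C (f::'h::complex_inner)) (at t)"
  using bounded_linear_scaleC_left assms by (rule bounded_linear.has_vector_derivative)

lemma continuous_on_scaleC_left:
  assumes "continuous_on S \<phi>"
  shows "continuous_on S (\<lambda>t. \<phi> t *\<^sub>C (f::'h::complex_inner))"
  using bounded_linear_scaleC_left assms by (rule bounded_linear.continuous_on)

text \<open>The numbers \<open>(L\<^sub>0 u, u)\<close> include a vertical line in the complex plane. For
  \<open>u(t) = e\<^sup>i\<^sup>r\<^sup>t \<psi>(t) f\<close> the phases cancel in \<open>(u' + A u, u)\<close>, except for the factor \<open>ir\<close> that
  differentiation of the wave brings down.\<close>

lemma minimal_operator_form_unbounded:
  fixes A :: "('h::{complex_inner, banach, second_countable_topology} \<times> 'h) set"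
    and a b :: real
  assumes "a < b" "linear_operator type_space A" "(f, g) \<in> A" "f \<noteq> 0"
  obtains C D where "D > 0"
    and "\<And>r. \<exists>(x, y)\<in>minimal_operator a b A.
           vinner (L2_space a b) y x = C + \<i> * of_real r * of_real D"
proof -
  obtain \<psi> \<psi>' c where \<psi>': "\<And>t. (\<psi> has_real_derivative \<psi>' t) (at t)" "continuous_on UNIV \<psi>'"
    and c: "c \<in> {a<..<b}" "\<psi> c \<noteq> 0"
    and test: "\<And>r. (\<lambda>t. cis (r * t) * of_real (\<psi> t)) \<in> test_functions a b"
    using bump_exists[OF \<open>a < b\<close>] by metis
  have cont: "continuous_on UNIV \<psi>"
    using \<psi>'(1) by (auto intro!: continuous_at_imp_continuous_on DERIV_isCont)
  have sv: "single_valued A" and scale: "\<And>c. (c *\<^sub>C f, c *\<^sub>C g) \<in> A"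
    using assms(2,3) by (auto simp: linear_operator_def type_space_def)
  define M where "M = lebesgue_on {a<..<b}"
  define C where "C = (LINT t|M. of_real (\<psi>' t * \<psi> t * (norm f)\<^sup>2) + of_real ((\<psi> t)\<^sup>2) * cinner g f)"
  define D where "D = (LINT t|M. (\<psi> t)\<^sup>2) * (norm f)\<^sup>2"
  have "\<exists>(x, y)\<in>minimal_operator a b A.
      vinner (L2_space a b) y x = C + \<i> * of_real r * of_real D" for r
  proof -
    define \<phi> where "\<phi> t = cis (r * t) * complex_of_real (\<psi> t)" for t
    define \<phi>' where "\<phi>' t = cis (r * t) * of_real (\<psi>' t) + \<i> * of_real r * \<phi> t" for t
    define u where "u t = \<phi> t *\<^sub>C f" for t
    define v where "v t = \<phi>' t *\<^sub>C f + \<phi> t *\<^sub>C g" for t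
    have "(\<phi> has_vector_derivative \<phi>' t) (at t)" for t
      using has_vector_derivative_mult[OF cis_has_vector_derivative[of r t]
        has_vector_derivative_of_real[OF \<psi>'(1)]]
      unfolding \<phi>_def[abs_def] \<phi>'_def by (simp add: algebra_simps)
    then have u': "vector_derivative u (at t) = \<phi>' t *\<^sub>C f" for t
      unfolding u_def[abs_def]
      by (intro vector_derivative_at scaleC_left_has_vector_derivative)
    have Au: "op_apply A (u t) = \<phi> t *\<^sub>C g" for t
      unfolding u_def by (intro op_apply_eq sv scale)
    have "continuous_on UNIV \<phi>" "continuous_on UNIV \<phi>'"
      unfolding \<phi>_def[abs_def] \<phi>'_def[abs_def] by (intro continuous_intros cont \<psi>'(2))+
    then have L2: "u \<in> L2_fun a b" "v \<in> L2_fun a b"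
      unfolding u_def[abs_def] v_def[abs_def]
      by (intro continuous_L2_fun continuous_intros continuous_on_scaleC_left; simp)+
    have "u \<in> D0' a b A"
      unfolding D0'_def using test[of r] assms(3)
      by (auto intro!: exI[of _ 1] exI[of _ "\<lambda>_. \<phi>"] exI[of _ "\<lambda>_. f"] simp: u_def \<phi>_def[abs_def])
    then have "(L2_class a b u, L2_class a b v) \<in> L0' a b A"
      unfolding L0'_def v_def[abs_def] using u' Au by auto
    then have "(L2_class a b u, L2_class a b v) \<in> minimal_operator a b A"
      by (intro L0'_subset_minimal_operator L2)
    moreover have "vinner (L2_space a b) (L2_class a b v) (L2_class a b u) =
        C + \<i> * of_real r * of_real D"
    proof -
      have right: "cinner x (k *\<^sub>C y) = cnj k * cinner x y" for x y :: 'h and k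
        by (metis cinner_commute cinner_scaleC_left complex_cnj_mult)
      have cis: "cis s * cnj (cis s) = 1" for s
        by (simp add: cis_cnj cis_mult)
      have "cinner (v t) (u t) =
          \<phi>' t * cnj (\<phi> t) * cinner f f + \<phi> t * cnj (\<phi> t) * cinner g f" for t
        by (simp add: u_def v_def right cinner_add_left cinner_scaleC_left algebra_simps)
      moreover have "\<phi> t * cnj (\<phi> t) = of_real ((\<psi> t)\<^sup>2)" for t
        unfolding \<phi>_def using cis[of "r * t"] by (simp add: power2_eq_square)
      moreover have "\<phi>' t * cnj (\<phi> t) = of_real (\<psi>' t * \<psi> t) + \<i> * of_real r * of_real ((\<psi> t)\<^sup>2)" for t
        unfolding \<phi>'_def \<phi>_def using cis[of "r * t"]
        by (simp add: power2_eq_square algebra_simps) 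
      ultimately have form: "cinner (v t) (u t) =
          (of_real (\<psi>' t * \<psi> t * (norm f)\<^sup>2) + of_real ((\<psi> t)\<^sup>2) * cinner g f) +
            \<i> * of_real r * of_real ((norm f)\<^sup>2) * of_real ((\<psi> t)\<^sup>2)" for t
        by (simp add: norm_cinner algebra_simps)
      have int: "integrable M (\<lambda>t. of_real (\<psi>' t * \<psi> t * (norm f)\<^sup>2) + of_real ((\<psi> t)\<^sup>2) * cinner g f)"
        "integrable M (\<lambda>t. complex_of_real ((\<psi> t)\<^sup>2))"
        unfolding M_def by (intro continuous_integrable_interval continuous_intros cont \<psi>'(2))+
      have "vinner (L2_space a b) (L2_class a b v) (L2_class a b u) = (LINT t|M. cinner (v t) (u t))"
        unfolding M_def by (rule L2_vinner[OF L2(2,1)])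
      also have "\<dots> = C + \<i> * of_real r * of_real ((norm f)\<^sup>2) * (LINT t|M. complex_of_real ((\<psi> t)\<^sup>2))"
        unfolding form C_def using int
        by (subst Bochner_Integration.integral_add) simp_all
      also have "(LINT t|M. complex_of_real ((\<psi> t)\<^sup>2)) = of_real (LINT t|M. (\<psi> t)\<^sup>2)"
        by (rule integral_complex_of_real)
      finally show ?thesis
        by (simp add: D_def algebra_simps)
    qed
    ultimately show ?thesis
      by blast
  qed
  moreover have "D > 0"
    using integral_square_pos[OF cont c] \<open>f \<noteq> 0\<close> by (simp add: D_def M_def)
  ultimately show thesis
    using that by blast
qed

theorem theorem3p2:
  fixes A :: "('h::{complex_inner, banach, second_countable_topology} \<times> 'h) set"
    and a b :: real
  assumes "(UNIV :: 'h set) \<noteq> {0}"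
    and "a < b"
    and "self_adjoint type_space A"
    and "nonneg_operator type_space A"
    and "maps_W21_into_L2 a b A"
  shows "\<not> (\<exists>\<phi> L. 0 \<le> \<phi> \<and> \<phi> < pi / 2 \<and> L \<in> m_sectorial \<phi> (L2_space a b) \<and>
               minimal_operator a b A \<subseteq> L)"
proof
  assume "\<exists>\<phi> L. 0 \<le> \<phi> \<and> \<phi> < pi / 2 \<and> L \<in> m_sectorial \<phi> (L2_space a b) \<and>
               minimal_operator a b A \<subseteq> L"
  then obtain \<phi> L where \<phi>: "0 \<le> \<phi>" "\<phi> < pi / 2"
    and L: "L \<in> m_sectorial \<phi> (L2_space a b)" "minimal_operator a b A \<subseteq> L"
    by blast
  have A: "linear_operator type_space A" "densely_defined type_space A"
    using assms(3) by (auto simp: self_adjoint_def)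
  obtain f g where "(f, g) \<in> A" "f \<noteq> 0"
    using dense_domain_nontrivial[OF assms(1) A(2)] by blast
  then obtain C D where "D > 0" and form: "\<And>r. \<exists>(x, y)\<in>minimal_operator a b A.
      vinner (L2_space a b) y x = C + \<i> * of_real r * of_real D"
    using minimal_operator_form_unbounded[OF assms(2) A(1)] by blast
  have bound: "cos \<phi> * \<bar>Im C + r * D\<bar> \<le> sin \<phi> * Re C" for r
  proof -
    obtain x y where "(x, y) \<in> L" "vinner (L2_space a b) y x = C + \<i> * of_real r * of_real D"
      using form[of r] L(2) by blast
    moreover have "\<forall>(x, y)\<in>L. cos \<phi> * \<bar>Im (vinner (L2_space a b) y x)\<bar>
        \<le> sin \<phi> * Re (vinner (L2_space a b) y x)"
      using L(1) by (simp add: m_sectorial_def)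
    ultimately show ?thesis
      by fastforce
  qed
  have cos: "cos \<phi> > 0"
    using \<phi> by (intro cos_gt_zero_pi) auto
  \<comment> \<open>The imaginary part takes every real value; \<open>s\<close> lies just beyond the boundary of the sector.\<close>
  define s where "s = (sin \<phi> * Re C) / cos \<phi> + 1"
  have "cos \<phi> * \<bar>s\<bar> \<le> sin \<phi> * Re C"
    using bound[of "(s - Im C) / D"] \<open>D > 0\<close> by simp
  then have "cos \<phi> * s \<le> sin \<phi> * Re C"
    using cos by (smt (verit) mult_left_mono)
  then show False
    using cos by (simp add: s_def algebra_simps)
qed

end
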